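(* Consider 3D feature points observed in $n$ images (views). For $i=1,\dots,n$ let $R_i$ and $\boldsymbol t_i$ be the global rotation and global translation of the camera for view $i$. For each feature point let $X_i=(x_i,y_i,1)^T$ be its normalized image coordinate in view $i$, and let views $\varsigma\neq\eta$ be its left- and right-base views (the index of the feature point is suppressed in $X_i,\varsigma,\eta$). Then the following two constraints are equivalent. (1) (Linear global translation (LiGT) constraint.) For every feature point and every $i$ with $1\le i\le n$, $i\neq\varsigma$, $$B\,\boldsymbol t_\eta+C\,\boldsymbol t_i+D\,\boldsymbol t_\varsigma=0,$$ where $$B=[X_i]_\times R_{\varsigma,i}X_\varsigma\,\boldsymbol a_{\varsigma,\eta}^TR_\eta,\qquad C=\theta_{\varsigma,\eta}^2[X_i]_\times R_i,\qquad D=-(B+C).$$ Equivalently, $\mathbf L\cdot\mathbf t=0$, where $\mathbf t=(\boldsymbol t_1^T,\dots,\boldsymbol t_n^T)^T$ and $\mathbf L$ is the coefficient matrix obtained by stacking these equations over all feature points and all $i\ne\varsigma$. (2) (Depth-pose-only (DPO) constraint.) For every feature point and every $i$ with $1\le i\le n$, $i\neq\varsigma$, $$d_i^{(\varsigma,i)}X_i=d_\varsigma^{(\varsigma,\eta)}R_{\varsigma,i}X_\varsigma+\boldsymbol t_{\varsigma,i}.$$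
   Context: $R_i\in SO(3)$ and $\boldsymbol t_i\in\mathbb R^3$. For $v\in\mathbb R^3$, $[v]_\times$ is the antisymmetric matrix with $[v]_\times w=v\times w$, and $\|\cdot\|$ is the Euclidean norm. For a pair of distinct views $(i,j)$, $$R_{i,j}=R_jR_i^T,\qquad \boldsymbol t_{i,j}=R_j(\boldsymbol t_i-\boldsymbol t_j),\qquad \theta_{i,j}=\|[X_j]_\times R_{i,j}X_i\|,$$ $$\boldsymbol a_{i,j}^T=\left([R_{i,j}X_i]_\times X_j\right)^T[X_j]_\times,$$ $$d_i^{(i,j)}=\frac{\|[X_j]_\times \boldsymbol t_{i,j}\|}{\theta_{i,j}},\qquad d_j^{(i,j)}=\frac{\|[R_{i,j}X_i]_\times \boldsymbol t_{i,j}\|}{\theta_{i,j}}.$$ The quantities $d_i^{(i,j)}$ and $d_j^{(i,j)}$ are the expressions, in terms of poses and image points only, of the depths of the feature point in views $i$ and $j$; the base-view depth has the linear expression $d_\varsigma^{(\varsigma,\eta)}=\boldsymbol a_{\varsigma,\eta}^T\boldsymbol t_{\varsigma,\eta}/\theta_{\varsigma,\eta}^2$. Standing assumption: the depths of each feature point in the views are positive; in particular, of the two opposite-sign solutions $\pm\mathbf t$ of the linear constraint, the one with $\boldsymbol a_{\varsigma,\eta}^T\boldsymbol t_{\varsigma,\eta}\ge 0$ is meant. No condition on the values $\theta_{\varsigma,i}$ is part of the statement.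
   Formalization: Positive depths means: d_ς^{(ς,η)} and all d_i^{(ς,i)} are defined and positive (so θ_{ς,η} and θ_{ς,i} are nonzero; otherwise DPO is undefined), and the point back-projected from view ς at depth d_ς^{(ς,η)} has positive third camera coordinate in every view. *)

theory Defs
  imports "HOL-Analysis.Analysis"
begin

text \<open>
  Views are indexed by a finite type. The arguments \<open>R\<close> and \<open>t\<close> are the families of
  global rotations and translations; a point with world coordinates \<open>P\<close> has camera coordinates
  \<open>R i *v (P - t i)\<close> in view \<open>i\<close>. The argument \<open>x\<close> is the family of normalized image
  coordinates of one feature point.
\<close>

definition skew :: "real^3 \<Rightarrow> real^3^3" where
  "skew v = matrix (\<lambda>w. cross3 v w)"

lemma skew_mult_vec: "skew v *v w = cross3 v w"
  unfolding skew_def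
  by (rule matrix_works) (use bilinear_cross in \<open>simp add: bilinear_def linear_matrix_vector_mul_eq\<close>)

definition rel_rot :: "('n \<Rightarrow> real^3^3) \<Rightarrow> 'n \<Rightarrow> 'n \<Rightarrow> real^3^3" where
  "rel_rot R i j = R j ** transpose (R i)"

definition rel_trans :: "('n \<Rightarrow> real^3^3) \<Rightarrow> ('n \<Rightarrow> real^3) \<Rightarrow> 'n \<Rightarrow> 'n \<Rightarrow> real^3" where
  "rel_trans R t i j = R j *v (t i - t j)"

definition parallax :: "('n \<Rightarrow> real^3^3) \<Rightarrow> ('n \<Rightarrow> real^3) \<Rightarrow> 'n \<Rightarrow> 'n \<Rightarrow> real" where
  "parallax R x i j = norm (skew (x j) *v (rel_rot R i j *v x i))"

text \<open>The row vector \<open>a\<^sub>i\<^sub>j\<^sup>T\<close>, represented as a plain vector.\<close>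

definition a_vec :: "('n \<Rightarrow> real^3^3) \<Rightarrow> ('n \<Rightarrow> real^3) \<Rightarrow> 'n \<Rightarrow> 'n \<Rightarrow> real^3" where
  "a_vec R x i j = (skew (rel_rot R i j *v x i) *v x j) v* skew (x j)"

text \<open>
  The depth expressions of the pair \<open>(i, j)\<close>: \<open>depth_fst\<close> is the one for view \<open>i\<close>, and
  \<open>depth_snd\<close> the one for view \<open>j\<close>. Since division by zero yields zero, both are zero when
  \<open>parallax R x i j = 0\<close>.
\<close>

definition depth_fst ::
  "('n \<Rightarrow> real^3^3) \<Rightarrow> ('n \<Rightarrow> real^3) \<Rightarrow> ('n \<Rightarrow> real^3) \<Rightarrow> 'n \<Rightarrow> 'n \<Rightarrow> real" where
  "depth_fst R t x i j = norm (skew (x j) *v rel_trans R t i j) / parallax R x i j"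

definition depth_snd ::
  "('n \<Rightarrow> real^3^3) \<Rightarrow> ('n \<Rightarrow> real^3) \<Rightarrow> ('n \<Rightarrow> real^3) \<Rightarrow> 'n \<Rightarrow> 'n \<Rightarrow> real" where
  "depth_snd R t x i j =
     norm (skew (rel_rot R i j *v x i) *v rel_trans R t i j) / parallax R x i j"

text \<open>
  The 3D feature point in world coordinates, back-projected from the left-base view \<open>s\<close> at the
  depth obtained from the base views \<open>(s, e)\<close>, and the depth of a world point in view \<open>i\<close>
  (its third camera coordinate).
\<close>

definition feature_point ::
  "('n \<Rightarrow> real^3^3) \<Rightarrow> ('n \<Rightarrow> real^3) \<Rightarrow> ('n \<Rightarrow> real^3) \<Rightarrow> 'n \<Rightarrow> 'n \<Rightarrow> real^3" where
  "feature_point R t x s e = t s + depth_fst R t x s e *\<^sub>R (transpose (R s) *v x s)"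

definition view_depth :: "('n \<Rightarrow> real^3^3) \<Rightarrow> ('n \<Rightarrow> real^3) \<Rightarrow> real^3 \<Rightarrow> 'n \<Rightarrow> real" where
  "view_depth R t P i = (R i *v (P - t i)) $ 3"

text \<open>
  The depth expressions are quotients of norms and hence blind to the sign of the depth.
  Positivity of the depths therefore also needs the signed depth of the feature point in each view.
  Positivity of a depth expression entails that its denominator is nonzero.
\<close>

definition positive_depths ::
  "('n \<Rightarrow> real^3^3) \<Rightarrow> ('n \<Rightarrow> real^3) \<Rightarrow> ('n \<Rightarrow> real^3) \<Rightarrow> 'n \<Rightarrow> 'n \<Rightarrow> bool" where
  "positive_depths R t x s e \<longleftrightarrow>
     a_vec R x s e \<bullet> rel_trans R t s e \<ge> 0 \<and>
     depth_fst R t x s e > 0 \<and>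
     (\<forall>i. i \<noteq> s \<longrightarrow> depth_snd R t x s i > 0) \<and>
     (\<forall>i. view_depth R t (feature_point R t x s e) i > 0)"

definition B_mat ::
  "('n \<Rightarrow> real^3^3) \<Rightarrow> ('n \<Rightarrow> real^3) \<Rightarrow> 'n \<Rightarrow> 'n \<Rightarrow> 'n \<Rightarrow> real^3^3" where
  "B_mat R x s e i =
     (columnvector (skew (x i) *v (rel_rot R s i *v x s)) :: real^1^3) **
     (rowvector (a_vec R x s e) :: real^3^1) ** R e"

definition C_mat ::
  "('n \<Rightarrow> real^3^3) \<Rightarrow> ('n \<Rightarrow> real^3) \<Rightarrow> 'n \<Rightarrow> 'n \<Rightarrow> 'n \<Rightarrow> real^3^3" where
  "C_mat R x s e i = (parallax R x s e)\<^sup>2 *\<^sub>R (skew (x i) ** R i)"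

definition D_mat ::
  "('n \<Rightarrow> real^3^3) \<Rightarrow> ('n \<Rightarrow> real^3) \<Rightarrow> 'n \<Rightarrow> 'n \<Rightarrow> 'n \<Rightarrow> real^3^3" where
  "D_mat R x s e i = - (B_mat R x s e i + C_mat R x s e i)"

text \<open>
  Below, \<open>X p i\<close> is the image of feature point \<open>p\<close> in view \<open>i\<close>; \<open>s p\<close> and \<open>e p\<close>
  are the left- and right-base views of \<open>p\<close>.
\<close>

definition LiGT ::
  "('n \<Rightarrow> real^3^3) \<Rightarrow> ('n \<Rightarrow> real^3) \<Rightarrow> ('p \<Rightarrow> 'n \<Rightarrow> real^3) \<Rightarrow> ('p \<Rightarrow> 'n) \<Rightarrow> ('p \<Rightarrow> 'n) \<Rightarrow> bool"
  where
  "LiGT R t X s e \<longleftrightarrow>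
     (\<forall>p i. i \<noteq> s p \<longrightarrow>
        B_mat R (X p) (s p) (e p) i *v t (e p) + C_mat R (X p) (s p) (e p) i *v t i
          + D_mat R (X p) (s p) (e p) i *v t (s p) = 0)"

definition DPO ::
  "('n \<Rightarrow> real^3^3) \<Rightarrow> ('n \<Rightarrow> real^3) \<Rightarrow> ('p \<Rightarrow> 'n \<Rightarrow> real^3) \<Rightarrow> ('p \<Rightarrow> 'n) \<Rightarrow> ('p \<Rightarrow> 'n) \<Rightarrow> bool"
  where
  "DPO R t X s e \<longleftrightarrow>
     (\<forall>p i. i \<noteq> s p \<longrightarrow>
        depth_snd R t (X p) (s p) i *\<^sub>R X p i =
          depth_fst R t (X p) (s p) (e p) *\<^sub>R (rel_rot R (s p) i *v X p (s p))
            + rel_trans R t (s p) i)"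

definition stack_trans :: "('n::finite \<Rightarrow> real^3) \<Rightarrow> real^('n \<times> 3)" where
  "stack_trans t = (\<chi> c. t (fst c) $ snd c)"

text \<open>
  The 3x3 block in block column \<open>j\<close> of the block row for \<open>(p, i)\<close>. The blocks are added
  because the block columns of \<open>B\<close> and \<open>C\<close> coincide when \<open>i = e p\<close>.
\<close>

definition LiGT_block ::
  "('n \<Rightarrow> real^3^3) \<Rightarrow> ('p \<Rightarrow> 'n \<Rightarrow> real^3) \<Rightarrow> ('p \<Rightarrow> 'n) \<Rightarrow> ('p \<Rightarrow> 'n) \<Rightarrow> 'p \<Rightarrow> 'n \<Rightarrow> 'n \<Rightarrow> real^3^3"
  where
  "LiGT_block R X s e p i j =
     (if j = e p then B_mat R (X p) (s p) (e p) i else 0)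
     + (if j = i then C_mat R (X p) (s p) (e p) i else 0)
     + (if j = s p then D_mat R (X p) (s p) (e p) i else 0)"

text \<open>
  The stacked coefficient matrix. The function \<open>r\<close> lists the pairs \<open>(p, i)\<close> with
  \<open>i \<noteq> s p\<close> in the order in which their block rows are stacked.
\<close>

definition LiGT_matrix ::
  "('n::finite \<Rightarrow> real^3^3) \<Rightarrow> ('p \<Rightarrow> 'n \<Rightarrow> real^3) \<Rightarrow> ('p \<Rightarrow> 'n) \<Rightarrow> ('p \<Rightarrow> 'n) \<Rightarrow> ('m::finite \<Rightarrow> 'p \<times> 'n)
    \<Rightarrow> real^('n \<times> 3)^('m \<times> 3)" where
  "LiGT_matrix R X s e r =
     (\<chi> a c. LiGT_block R X s e (fst (r (fst a))) (snd (r (fst a))) (fst c) $ snd a $ snd c)"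

end

theory Submission
  imports Defs
begin

text \<open>
  Write \<open>y\<^sub>i = R\<^bsub>s,i\<^esub> X\<^sub>s\<close>. The LiGT equation of view \<open>i\<close> says
  \<open>X\<^sub>i \<times> ((a\<^sup>T t\<^bsub>s,e\<^esub>) y\<^sub>i + \<theta>\<^bsub>s,e\<^esub>\<^sup>2 t\<^bsub>s,i\<^esub>) = 0\<close>.
  Taking norms in the equation of view \<open>e\<close> identifies \<open>a\<^sup>T t\<^bsub>s,e\<^esub> / \<theta>\<^bsub>s,e\<^esub>\<^sup>2\<close> with the depth
  \<open>d\<^sub>s\<close>, so that \<open>d\<^sub>s y\<^sub>i + t\<^bsub>s,i\<^esub>\<close> is parallel to \<open>X\<^sub>i\<close>; the factor is its third
  component, the positive depth of the feature point in view \<open>i\<close>, and taking the cross product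
  with \<open>y\<^sub>i\<close> shows that it is \<open>d\<^sub>i\<close>. Conversely, crossing the DPO equation with \<open>X\<^sub>i\<close>
  eliminates \<open>d\<^sub>i\<close>.
\<close>

lemma vector_mult_skew: "v v* skew w = cross3 v w"
proof -
  have "(v v* skew w) \<bullet> u = cross3 v w \<bullet> u" for u
    by (metis cross_triple dot_lmul_matrix inner_commute skew_mult_vec)
  then show ?thesis
    by (metis vector_eq_rdot)
qed

lemma columnvector_rowvector_mult_vec:
  fixes u :: "'a::comm_semiring_1^'m" and v w :: "'a^'n"
  shows "((columnvector u :: 'a^1^'m) ** (rowvector v :: 'a^'n^1)) *v w = (\<Sum>j\<in>UNIV. v $ j * w $ j) *s u"
  by (simp add: vec_eq_iff matrix_matrix_mult_def matrix_vector_mult_def columnvector_def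
      rowvector_def sum_distrib_left sum_distrib_right mult_ac)

text \<open>A vanishing cross product makes \<open>v\<close> a multiple of the nonzero vector
  \<open>x\<close>; the normalization of \<open>x\<close> fixes the factor.\<close>

lemma parallel_third_component:
  assumes "cross3 x v = 0" and "x $ 3 = 1"
  shows "v = v $ 3 *\<^sub>R x"
proof -
  have "x$1 * v$2 = x$2 * v$1" "x$2 * v$3 = v$2" "v$1 = x$1 * v$3"
    using assms by (simp_all add: cross3_def vec_eq_iff forall_3)
  then show ?thesis
    using assms(2) by (simp add: vec_eq_iff forall_3 mult.commute)
qed

text \<open>Cyclicity of the triple product. If \<open>cross3 (x j) v\<close> is a multiple of
  \<open>cross3 (x j) (rel_rot R i j *v x i)\<close>, this yields a multiple of the squared
  parallax.\<close>

lemma a_vec_inner: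
  "a_vec R x i j \<bullet> v = cross3 (rel_rot R i j *v x i) (x j) \<bullet> cross3 (x j) v"
  by (metis a_vec_def cross_triple inner_commute skew_mult_vec vector_mult_skew)

text \<open>Because D = -(B + C), only the differences \<open>t e - t s\<close> and
  \<open>t i - t s\<close> enter; they are opposite to those in \<open>rel_trans\<close>, whence the
  minus sign.\<close>

lemma LiGT_equation:
  "B_mat R x s e i *v t e + C_mat R x s e i *v t i + D_mat R x s e i *v t s =
     - cross3 (x i) ((a_vec R x s e \<bullet> rel_trans R t s e) *\<^sub>R (rel_rot R s i *v x s)
       + (parallax R x s e)\<^sup>2 *\<^sub>R rel_trans R t s i)"
proof -
  have B: "B_mat R x s e i *v (t e - t s) =
      - (a_vec R x s e \<bullet> rel_trans R t s e) *\<^sub>R cross3 (x i) (rel_rot R s i *v x s)"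
  proof -
    \<comment> \<open>\<open>B_mat\<close> is a rank-one outer product times \<open>R e\<close>: it
      evaluates a functional and scales a fixed vector by the result.\<close>
    have "B_mat R x s e i *v (t e - t s) =
        (a_vec R x s e \<bullet> (R e *v (t e - t s))) *\<^sub>R cross3 (x i) (rel_rot R s i *v x s)"
      by (simp only: B_mat_def matrix_vector_mul_assoc [symmetric]
          columnvector_rowvector_mult_vec [unfolded matrix_vector_mul_assoc [symmetric]]
          skew_mult_vec inner_vec_def inner_real_def scalar_mult_eq_scaleR)
    moreover have "R e *v (t e - t s) = - rel_trans R t s e"
      by (simp add: rel_trans_def matrix_vector_mult_diff_distrib)
    ultimately show ?thesis
      by simp
  qed
  have C: "C_mat R x s e i *v (t i - t s) =
      - (parallax R x s e)\<^sup>2 *\<^sub>R cross3 (x i) (rel_trans R t s i)"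
  proof -
    have "R i *v (t i - t s) = - rel_trans R t s i"
      by (simp add: rel_trans_def matrix_vector_mult_diff_distrib)
    then show ?thesis
      by (simp add: C_mat_def scaleR_matrix_vector_assoc [symmetric]
          matrix_vector_mul_assoc [symmetric] skew_mult_vec cross_minus_right)
  qed
  have "D_mat R x s e i *v t s = - (B_mat R x s e i *v t s) - C_mat R x s e i *v t s"
    by (simp add: D_mat_def matrix_vector_mult_def vec_eq_iff sum.distrib sum_negf
        sum_subtractf algebra_simps)
  then have "B_mat R x s e i *v t e + C_mat R x s e i *v t i + D_mat R x s e i *v t s =
      B_mat R x s e i *v (t e - t s) + C_mat R x s e i *v (t i - t s)"
    by (simp add: matrix_vector_mult_diff_distrib)
  then show ?thesis
    by (simp add: B C cross_add_right cross_mult_right)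
qed

text \<open>The camera coordinates of the back-projected point in view \<open>i\<close> are the
  right-hand side of the DPO equation, so positivity of the signed depth controls the sign
  there.\<close>

lemma view_depth_feature_point:
  "view_depth R t (feature_point R t x s e) i =
     (depth_fst R t x s e *\<^sub>R (rel_rot R s i *v x s) + rel_trans R t s i) $ 3"
proof -
  have "R i *v (feature_point R t x s e - t i) =
      R i *v (depth_fst R t x s e *\<^sub>R (transpose (R s) *v x s) + (t s - t i))"
    by (simp add: feature_point_def algebra_simps)
  also have "\<dots> = depth_fst R t x s e *\<^sub>R (rel_rot R s i *v x s) + rel_trans R t s i"
    by (simp only: matrix_vector_right_distrib matrix_vector_mult_scaleR rel_rot_def
        rel_trans_def matrix_vector_mul_assoc)
  finally show ?thesis
    by (simp add: view_depth_def)
qed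

lemma depth_equation_iff:
  assumes "x i $ 3 = 1"
    and snd_pos: "depth_snd R t x s i > 0"
    and view_pos: "view_depth R t (feature_point R t x s e) i > 0"
  shows "depth_snd R t x s i *\<^sub>R x i =
      depth_fst R t x s e *\<^sub>R (rel_rot R s i *v x s) + rel_trans R t s i \<longleftrightarrow>
    cross3 (x i) (depth_fst R t x s e *\<^sub>R (rel_rot R s i *v x s) + rel_trans R t s i) = 0"
    (is "?d *\<^sub>R x i = ?v \<longleftrightarrow> _")
proof
  assume "?d *\<^sub>R x i = ?v"
  then show "cross3 (x i) ?v = 0"
    by (metis cross_mult_right cross_refl scale_zero_right)
next
  let ?y = "rel_rot R s i *v x s" and ?l = "?v $ 3"
  assume "cross3 (x i) ?v = 0"
  then have v: "?v = ?l *\<^sub>R x i"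
    using assms(1) by (rule parallel_third_component)
  \<comment> \<open>Norms determine \<open>?l\<close> only up to sign; the signed depth settles
    it.\<close>
  have l: "?l > 0"
    using view_pos by (simp only: view_depth_feature_point)
  \<comment> \<open>Crossing with \<open>?y\<close> kills the base-depth term and produces the
    numerator of \<open>depth_snd\<close>.\<close>
  have "cross3 ?y (rel_trans R t s i) = cross3 ?y ?v"
    by (simp add: cross_add_right cross_mult_right)
  also have "\<dots> = ?l *\<^sub>R cross3 ?y (x i)"
    by (subst v) (rule cross_mult_right)
  finally have "norm (cross3 ?y (rel_trans R t s i)) = ?l * norm (cross3 ?y (x i))"
    using l by simp
  also have "norm (cross3 ?y (x i)) = parallax R x s i"
    by (metis cross_skew norm_minus_cancel parallax_def skew_mult_vec)
  \<comment> \<open>A zero parallax would make the quotient \<open>?d\<close> zero, so clearing the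
    denominator is legitimate.\<close>
  finally have "?d * parallax R x s i = ?l * parallax R x s i"
    using snd_pos by (auto simp: depth_snd_def skew_mult_vec)
  moreover have "parallax R x s i \<noteq> 0"
    using snd_pos by (auto simp: depth_snd_def)
  ultimately have "?d = ?l"
    by simp
  with v show "?d *\<^sub>R x i = ?v"
    by (simp only:)
qed

lemma base_depth_linear:
  assumes "parallax R x s e \<noteq> 0"
    and "a_vec R x s e \<bullet> rel_trans R t s e \<ge> 0"
    and eq: "cross3 (x e) ((a_vec R x s e \<bullet> rel_trans R t s e) *\<^sub>R (rel_rot R s e *v x s)
       + (parallax R x s e)\<^sup>2 *\<^sub>R rel_trans R t s e) = 0"
  shows "a_vec R x s e \<bullet> rel_trans R t s e = (parallax R x s e)\<^sup>2 * depth_fst R t x s e"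
proof -
  let ?\<alpha> = "a_vec R x s e \<bullet> rel_trans R t s e" and ?\<theta> = "parallax R x s e"
  have "?\<alpha> *\<^sub>R cross3 (x e) (rel_rot R s e *v x s) = - (?\<theta>\<^sup>2 *\<^sub>R cross3 (x e) (rel_trans R t s e))"
    using eq by (simp add: cross_add_right cross_mult_right eq_neg_iff_add_eq_0)
  then have "norm (?\<alpha> *\<^sub>R cross3 (x e) (rel_rot R s e *v x s)) =
      norm (?\<theta>\<^sup>2 *\<^sub>R cross3 (x e) (rel_trans R t s e))"
    by simp
  \<comment> \<open>The norm on the left contributes the absolute value of \<open>?\<alpha>\<close>,
    which the sign condition removes.\<close>
  then have "?\<alpha> * ?\<theta> = ?\<theta>\<^sup>2 * norm (cross3 (x e) (rel_trans R t s e))"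
    using assms(2) by (simp add: parallax_def skew_mult_vec)
  then show ?thesis
    using assms(1) by (simp add: depth_fst_def skew_mult_vec field_simps)
qed

text \<open>The counterpart of \<open>base_depth_linear\<close> for the converse direction, by
  \<open>a_vec_inner\<close>; the minus sign from the assumption cancels against the one from
  swapping the factors of a cross product.\<close>

lemma a_vec_inner_rel_trans:
  assumes "cross3 (x e) (d *\<^sub>R (rel_rot R s e *v x s) + rel_trans R t s e) = 0"
  shows "a_vec R x s e \<bullet> rel_trans R t s e = (parallax R x s e)\<^sup>2 * d"
proof -
  let ?y = "rel_rot R s e *v x s"
  have "cross3 (x e) (rel_trans R t s e) = - (d *\<^sub>R cross3 (x e) ?y)"
    using assms by (simp add: cross_add_right cross_mult_right eq_neg_iff_add_eq_0 add.commute)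
  then show ?thesis
    by (simp add: a_vec_inner parallax_def skew_mult_vec power2_norm_eq_inner
        cross_skew [of ?y "x e"])
qed

lemma LiGT_iff_DPO_point:
  fixes x :: "'n \<Rightarrow> real^3"
  assumes img: "\<And>i. x i $ 3 = 1"
    and base: "s \<noteq> e"
    and pos: "positive_depths R t x s e"
  shows "(\<forall>i. i \<noteq> s \<longrightarrow>
        B_mat R x s e i *v t e + C_mat R x s e i *v t i + D_mat R x s e i *v t s = 0) \<longleftrightarrow>
      (\<forall>i. i \<noteq> s \<longrightarrow>
        depth_snd R t x s i *\<^sub>R x i =
          depth_fst R t x s e *\<^sub>R (rel_rot R s i *v x s) + rel_trans R t s i)"
proof -
  let ?\<alpha> = "a_vec R x s e \<bullet> rel_trans R t s e" and ?\<theta> = "parallax R x s e"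
    and ?d = "depth_fst R t x s e"
  let ?L = "\<lambda>i. cross3 (x i) (?\<alpha> *\<^sub>R (rel_rot R s i *v x s) + ?\<theta>\<^sup>2 *\<^sub>R rel_trans R t s i) = 0"
    and ?P = "\<lambda>i. cross3 (x i) (?d *\<^sub>R (rel_rot R s i *v x s) + rel_trans R t s i) = 0"
  have \<theta>: "?\<theta> \<noteq> 0" and \<alpha>: "?\<alpha> \<ge> 0"
    using pos by (auto simp: positive_depths_def depth_fst_def)
  \<comment> \<open>Under this identity the two cross products differ only by the nonzero factor
    \<open>?\<theta>\<^sup>2\<close>.\<close>
  have L_iff_P: "?L i \<longleftrightarrow> ?P i" if "?\<alpha> = ?\<theta>\<^sup>2 * ?d" for i
  proof -
    have "cross3 (x i) (?\<alpha> *\<^sub>R (rel_rot R s i *v x s) + ?\<theta>\<^sup>2 *\<^sub>R rel_trans R t s i) =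
        ?\<theta>\<^sup>2 *\<^sub>R cross3 (x i) (?d *\<^sub>R (rel_rot R s i *v x s) + rel_trans R t s i)"
      by (simp add: that cross_add_right cross_mult_right scaleR_add_right)
    with \<theta> show ?thesis
      by simp
  qed
  \<comment> \<open>Each side supplies the identity through its own equation at
    \<open>i = e\<close>, an admissible view since \<open>s \<noteq> e\<close>.\<close>
  have "(\<forall>i. i \<noteq> s \<longrightarrow> ?L i) \<longleftrightarrow> (\<forall>i. i \<noteq> s \<longrightarrow> ?P i)"
  proof
    assume L: "\<forall>i. i \<noteq> s \<longrightarrow> ?L i"
    then have "?\<alpha> = ?\<theta>\<^sup>2 * ?d"
      using base base_depth_linear [OF \<theta> \<alpha>] by simp
    with L show "\<forall>i. i \<noteq> s \<longrightarrow> ?P i"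
      using L_iff_P by blast
  next
    assume P: "\<forall>i. i \<noteq> s \<longrightarrow> ?P i"
    then have "?\<alpha> = ?\<theta>\<^sup>2 * ?d"
      using base a_vec_inner_rel_trans [of x e ?d R s t] by simp
    with P show "\<forall>i. i \<noteq> s \<longrightarrow> ?L i"
      using L_iff_P by blast
  qed
  moreover have "depth_snd R t x s i *\<^sub>R x i =
      ?d *\<^sub>R (rel_rot R s i *v x s) + rel_trans R t s i \<longleftrightarrow> ?P i" if "i \<noteq> s" for i
    by (rule depth_equation_iff) (use pos img that in \<open>auto simp: positive_depths_def\<close>)
  ultimately show ?thesis
    by (simp add: LiGT_equation)
qed

lemma LiGT_matrix_mult_vec:
  "(LiGT_matrix R X s e r *v stack_trans t) $ (m, k) =
     (case r m of (p, i) \<Rightarrow>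
        B_mat R (X p) (s p) (e p) i *v t (e p) + C_mat R (X p) (s p) (e p) i *v t i
          + D_mat R (X p) (s p) (e p) i *v t (s p)) $ k"
proof (cases "r m")
  case (Pair p i)
  let ?B = "B_mat R (X p) (s p) (e p) i" and ?C = "C_mat R (X p) (s p) (e p) i"
    and ?D = "D_mat R (X p) (s p) (e p) i"
  have "(LiGT_matrix R X s e r *v stack_trans t) $ (m, k) =
      (\<Sum>c\<in>UNIV. LiGT_block R X s e p i (fst c) $ k $ snd c * t (fst c) $ snd c)"
    by (simp add: matrix_vector_mult_def LiGT_matrix_def stack_trans_def Pair)
  also have "\<dots> = (\<Sum>j\<in>UNIV. \<Sum>l\<in>UNIV. LiGT_block R X s e p i j $ k $ l * t j $ l)"
    by (simp add: UNIV_Times_UNIV [symmetric] sum.cartesian_product case_prod_beta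
        del: UNIV_Times_UNIV)
  also have "\<dots> = (\<Sum>j\<in>UNIV. (LiGT_block R X s e p i j *v t j) $ k)"
    by (simp add: matrix_vector_mult_def)
  \<comment> \<open>Each indicator selects one block column; keeping the three apart lets coinciding
    columns add up correctly.\<close>
  also have "\<dots> = (\<Sum>j\<in>UNIV. (if j = e p then (?B *v t j) $ k else 0)
      + (if j = i then (?C *v t j) $ k else 0) + (if j = s p then (?D *v t j) $ k else 0))"
    by (rule sum.cong) (auto simp: LiGT_block_def matrix_vector_mult_add_rdistrib)
  also have "\<dots> = (?B *v t (e p) + ?C *v t i + ?D *v t (s p)) $ k"
    by (simp add: sum.distrib)
  finally show ?thesis
    by (simp add: Pair)
qed

lemma LiGT_iff_LiGT_matrix:
  fixes r :: "'m::finite \<Rightarrow> 'p \<times> 'n::finite"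
  assumes "bij_betw r UNIV {(p, i). i \<noteq> s p}"
  shows "LiGT R t X s e \<longleftrightarrow> LiGT_matrix R X s e r *v stack_trans t = 0"
proof -
  let ?E = "\<lambda>(p, i). B_mat R (X p) (s p) (e p) i *v t (e p) + C_mat R (X p) (s p) (e p) i *v t i
      + D_mat R (X p) (s p) (e p) i *v t (s p)"
  have "LiGT_matrix R X s e r *v stack_trans t = 0 \<longleftrightarrow> (\<forall>m k. ?E (r m) $ k = 0)"
    unfolding vec_eq_iff [where 'b = "'m \<times> 3"] by (simp add: LiGT_matrix_mult_vec)
  also have "\<dots> \<longleftrightarrow> (\<forall>m. ?E (r m) = 0)"
    by (simp add: vec_eq_iff)
  also have "\<dots> \<longleftrightarrow> (\<forall>q\<in>range r. ?E q = 0)"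
    by blast
  \<comment> \<open>The range of \<open>r\<close> is exactly the index set of the LiGT
    equations.\<close>
  also have "\<dots> \<longleftrightarrow> LiGT R t X s e"
    using assms by (auto simp: bij_betw_def LiGT_def)
  finally show ?thesis ..
qed

theorem proposition5:
  fixes R :: "'n::finite \<Rightarrow> real^3^3"
    and t :: "'n \<Rightarrow> real^3"
    and X :: "'p \<Rightarrow> 'n \<Rightarrow> real^3"
    and s e :: "'p \<Rightarrow> 'n"
  assumes rot: "\<And>i. rotation_matrix (R i)"
    and img: "\<And>p i. X p i $ 3 = 1"
    and base: "\<And>p. s p \<noteq> e p"
    and pos: "\<And>p. positive_depths R t (X p) (s p) (e p)"
  shows "(LiGT R t X s e \<longleftrightarrow> DPO R t X s e) \<and>
         (\<forall>r :: 'm::finite \<Rightarrow> 'p \<times> 'n.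
            bij_betw r UNIV {(p, i). i \<noteq> s p} \<longrightarrow>
            (LiGT R t X s e \<longleftrightarrow> LiGT_matrix R X s e r *v stack_trans t = 0))"
proof (intro conjI allI impI)
  show "LiGT R t X s e \<longleftrightarrow> DPO R t X s e"
    unfolding LiGT_def DPO_def using LiGT_iff_DPO_point [OF img base pos] by blast
qed (rule LiGT_iff_LiGT_matrix)

end
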